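(* Let $r \geq 3$ be an integer and let $P_r$ be the path on $r$ vertices. Then the limit $\operatorname{csat}(P_r) = \lim_{n\to\infty} \operatorname{csat}(n,P_r)/n$ exists, and $$\operatorname{csat}(P_r) = \begin{cases} 1 - \dfrac{1}{3j}, & \text{if } r = 2j+1, \\[2mm] 1 - \dfrac{1}{3j+1}, & \text{if } r = 2j+2, \end{cases}$$ where $j \geq 1$ is an integer.
   Context: All graphs are simple, finite and undirected, and have at least one edge. A "copy of $F$" in $G$ is a (not necessarily induced) subgraph of $G$ isomorphic to $F$. A graph $G$ is $F$-covered if every edge of $G$ lies in a copy of $F$ in $G$. A graph $G$ is $F$-semi-saturated if for every edge $e$ of the complement of $G$, the graph $G+e$ contains more copies of $F$ than $G$ does (equivalently, $G+e$ contains a copy of $F$ using $e$). A graph is $F$-cov-sat if it is both $F$-covered and $F$-semi-saturated. For $n \geq |F|$ (where $|F|$ is the number of vertices of $F$), $\operatorname{csat}(n,F)$ is the minimum number of edges of an $F$-cov-sat graph on exactly $n$ vertices. *)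

theory Defs
  imports Complex_Main "HOL-Library.Ramsey"
begin

type_synonym 'a graph = "'a set \<times> 'a set set"

abbreviation verts :: "'a graph \<Rightarrow> 'a set" where
  "verts \<equiv> fst"

abbreviation edges :: "'a graph \<Rightarrow> 'a set set" where
  "edges \<equiv> snd"

text \<open>Throughout, a graph is simple, finite, undirected, and has at least one edge.\<close>

definition is_graph :: "'a graph \<Rightarrow> bool" where
  "is_graph G \<longleftrightarrow> finite (verts G) \<and> edges G \<subseteq> [verts G]\<^bsup>2\<^esup> \<and> edges G \<noteq> {}"

definition subgraph :: "'a graph \<Rightarrow> 'a graph \<Rightarrow> bool" where
  "subgraph H G \<longleftrightarrow> is_graph H \<and> verts H \<subseteq> verts G \<and> edges H \<subseteq> edges G"

definition isomorphic :: "'a graph \<Rightarrow> 'b graph \<Rightarrow> bool" where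
  "isomorphic G H \<longleftrightarrow>
     (\<exists>f. bij_betw f (verts G) (verts H) \<and> edges H = (\<lambda>e. f ` e) ` edges G)"

definition copies :: "'b graph \<Rightarrow> 'a graph \<Rightarrow> 'a graph set" where
  "copies F G = {H. subgraph H G \<and> isomorphic F H}"

definition covered :: "'b graph \<Rightarrow> 'a graph \<Rightarrow> bool" where
  "covered F G \<longleftrightarrow> (\<forall>e\<in>edges G. \<exists>H\<in>copies F G. e \<in> edges H)"

definition complement_edges :: "'a graph \<Rightarrow> 'a set set" where
  "complement_edges G = [verts G]\<^bsup>2\<^esup> - edges G"

definition add_edge :: "'a graph \<Rightarrow> 'a set \<Rightarrow> 'a graph" where
  "add_edge G e = (verts G, insert e (edges G))"

definition semi_saturated :: "'b graph \<Rightarrow> 'a graph \<Rightarrow> bool" where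
  "semi_saturated F G \<longleftrightarrow>
     (\<forall>e\<in>complement_edges G. card (copies F G) < card (copies F (add_edge G e)))"

definition cov_sat :: "'b graph \<Rightarrow> 'a graph \<Rightarrow> bool" where
  "cov_sat F G \<longleftrightarrow> covered F G \<and> semi_saturated F G"

text \<open>Every finite graph has an isomorphic copy with vertices in \<^typ>\<open>nat\<close>, so it suffices to
  minimise over those. For \<open>n \<ge> card (verts F)\<close> the complete graph on \<open>n\<close> vertices is a
  candidate, so the minimum is attained; for smaller \<open>n\<close> the value has no meaning.\<close>

definition csat :: "nat \<Rightarrow> 'b graph \<Rightarrow> nat" where
  "csat n F = (LEAST m. \<exists>G :: nat graph.
     is_graph G \<and> card (verts G) = n \<and> cov_sat F G \<and> card (edges G) = m)"

definition csat_ratio :: "'b graph \<Rightarrow> nat \<Rightarrow> real" where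
  "csat_ratio F n = real (csat n F) / real n"

definition csat_limit :: "'b graph \<Rightarrow> real" where
  "csat_limit F = lim (csat_ratio F)"

definition path_graph :: "nat \<Rightarrow> nat graph" where
  "path_graph r = ({..<r}, {{i, Suc i} | i. Suc i < r})"

end

theory Submission
  imports Defs
begin

text \<open>
  Both cases say that the limit is \<open>1 - 1/s\<close> with \<open>s = r + j - 1\<close>, where \<open>j\<close> is the largest integer
  with \<open>2 * j < r\<close>. The number \<open>s\<close> is the least order of a tree that contains \<open>P\<^sub>r\<close> and in which
  every added edge lies on a new \<open>P\<^sub>r\<close>.

  Lower bound. In an \<open>P\<^sub>r\<close>-cov-sat graph at most one vertex is isolated, since an edge between two
  isolated vertices lies on no path with three vertices. Every other component contains \<open>P\<^sub>r\<close> and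
  inherits the saturation property. If it has a cycle, it has at least as many edges as vertices, so
  its density is large enough. If it is a tree, take a longest path \<open>p\<close> in it and let \<open>u\<close>
  and \<open>v\<close> be its \<open>j\<close>-th vertices from the two ends; they are not adjacent, because \<open>p\<close> has more
  than \<open>2 * j\<close> vertices. A new \<open>P\<^sub>r\<close> through the added edge \<open>uv\<close> is a path \<open>A\<close> ending in \<open>u\<close> followed
  by a path \<open>B\<close> starting in \<open>v\<close>. If \<open>A\<close> leaves \<open>u\<close> away from \<open>v\<close>, it has at most \<open>j\<close> vertices, since
  otherwise it would give a path longer than \<open>p\<close>; if it leaves towards \<open>v\<close>, then neither \<open>A\<close> nor \<open>B\<close>
  meets the \<open>j - 1\<close> vertices of \<open>p\<close> before \<open>u\<close> (lemma \<open>longest_path_side\<close>). The same holds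
  for \<open>B\<close> at the other end. Since \<open>2 * j < r\<close>, at least one side is of the second kind, so \<open>r\<close> vertices of
  the tree avoid \<open>j - 1\<close> others (lemma \<open>saturated_tree_large\<close>).

  Upper bound. A disjoint union of paths, each with at least \<open>s\<close> vertices, is \<open>P\<^sub>r\<close>-cov-sat
  (lemma \<open>path_forest_cov_sat\<close>): this uses \<open>2 * s \<ge> 3 * r - 4\<close>, which is where the maximality of \<open>j\<close>
  enters. With as many components as possible there are \<open>n - n div s\<close> edges on \<open>n\<close> vertices. The two
  bounds differ by a constant, so dividing by \<open>n\<close> gives the limit.
\<close>

section \<open>Paths as lists of vertices\<close>

definition path_in :: "'a graph \<Rightarrow> 'a list \<Rightarrow> bool" where
  "path_in G xs \<longleftrightarrow> set xs \<subseteq> verts G \<and> distinct xs \<and>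
     successively (\<lambda>x y. {x, y} \<in> edges G) xs"

definition path_edges :: "'a list \<Rightarrow> 'a set set" where
  "path_edges xs = {{xs ! i, xs ! Suc i} | i. Suc i < length xs}"

lemma path_in_append_iff:
  "path_in G (xs @ ys) \<longleftrightarrow> path_in G xs \<and> path_in G ys \<and> set xs \<inter> set ys = {} \<and>
     (xs = [] \<or> ys = [] \<or> {last xs, hd ys} \<in> edges G)"
  by (auto simp: path_in_def successively_append_iff)

lemma path_in_rev [simp]: "path_in G (rev xs) \<longleftrightarrow> path_in G xs"
  by (simp add: path_in_def insert_commute)

lemma path_edges_subset: "path_in G xs \<Longrightarrow> path_edges xs \<subseteq> edges G"
  by (auto simp: path_in_def path_edges_def successively_conv_nth)

lemma path_in_mono:
  assumes "path_in G xs" "verts G = verts H" "edges G \<subseteq> edges H"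
  shows "path_in H xs"
  using assms by (auto simp: path_in_def elim!: successively_mono)

lemma middle_in_path_edges:
  assumes "xs \<noteq> []" "ys \<noteq> []"
  shows "{last xs, hd ys} \<in> path_edges (xs @ ys)"
  unfolding path_edges_def using assms
  by (auto intro!: exI[of _ "length xs - 1"] simp: nth_append last_conv_nth hd_conv_nth)

lemma path_edges_split:
  assumes "e \<in> path_edges xs"
  obtains ys zs where "xs = ys @ zs" "ys \<noteq> []" "zs \<noteq> []" "e = {last ys, hd zs}"
proof -
  obtain i where i: "Suc i < length xs" "e = {xs ! i, xs ! Suc i}"
    using assms by (auto simp: path_edges_def)
  show thesis
  proof (rule that)
    show "xs = take (Suc i) xs @ drop (Suc i) xs" by simp
    show "e = {last (take (Suc i) xs), hd (drop (Suc i) xs)}"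
      using i by (simp add: take_Suc_conv_app_nth hd_drop_conv_nth)
  qed (use i in auto)
qed

text \<open>The copies of \<^term>\<open>path_graph r\<close> come from the lists of \<^term>\<open>r\<close> vertices that run along edges;
  from here on, copies are handled only in this form.\<close>

lemma copies_path_graph:
  fixes G :: "'a graph"
  assumes "r \<ge> 2"
  shows "copies (path_graph r) G = {(set xs, path_edges xs) | xs. path_in G xs \<and> length xs = r}"
proof (intro equalityI subsetI)
  fix H assume "H \<in> copies (path_graph r) G"
  then obtain f where H: "subgraph H G" "bij_betw f {..<r} (verts H)"
      "edges H = (\<lambda>e. f ` e) ` {{i, Suc i} | i. Suc i < r}"
    by (auto simp: copies_def isomorphic_def path_graph_def)
  define xs where "xs = map f [0..<r]"
  have "set xs = verts H" "distinct xs" "length xs = r"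
    using H(2) by (auto simp: xs_def bij_betw_def distinct_map lessThan_atLeast0)
  moreover have "path_edges xs = edges H"
  proof -
    have "e = {xs ! i, xs ! Suc i} \<and> Suc i < length xs \<longleftrightarrow> e = f ` {i, Suc i} \<and> Suc i < r" for e i
      by (auto simp: xs_def)
    then have "path_edges xs = {f ` {i, Suc i} | i. Suc i < r}"
      by (simp only: path_edges_def)
    also have "\<dots> = edges H" unfolding H(3) by blast
    finally show ?thesis .
  qed
  moreover from this have "successively (\<lambda>x y. {x, y} \<in> edges G) xs"
    using H(1) by (auto simp: subgraph_def successively_conv_nth path_edges_def)
  ultimately show "H \<in> {(set xs, path_edges xs) | xs. path_in G xs \<and> length xs = r}"
    using H(1) by (auto simp: path_in_def subgraph_def intro!: exI[of _ xs] prod_eqI)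
next
  fix H assume "H \<in> {(set xs, path_edges xs) | xs. path_in G xs \<and> length xs = r}"
  then obtain xs where xs: "path_in G xs" "length xs = r" "H = (set xs, path_edges xs)"
    by auto
  have d: "distinct xs" using xs(1) by (simp add: path_in_def)
  have "{xs ! 0, xs ! 1} \<in> path_edges xs"
    using xs(2) assms by (auto simp: path_edges_def intro!: exI[of _ 0])
  then have "is_graph H"
    using xs(2,3) d by (auto simp: is_graph_def path_edges_def nth_eq_iff_index_eq)
  then have "subgraph H G"
    using xs(1,3) path_edges_subset[OF xs(1)] by (auto simp: subgraph_def path_in_def)
  moreover have "isomorphic (path_graph r) H"
    unfolding isomorphic_def
  proof (intro exI[of _ "nth xs"] conjI)
    show "bij_betw (nth xs) (verts (path_graph r)) (verts H)"
      using xs(2,3) d by (auto simp: path_graph_def intro: bij_betw_nth)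
    show "edges H = (\<lambda>e. (nth xs) ` e) ` edges (path_graph r)"
    proof -
      have "edges H = {(nth xs) ` {i, Suc i} | i. Suc i < r}"
        using xs(2,3) by (simp add: path_edges_def)
      also have "\<dots> = (\<lambda>e. (nth xs) ` e) ` {{i, Suc i} | i. Suc i < r}" by blast
      finally show ?thesis by (simp add: path_graph_def)
    qed
  qed
  ultimately show "H \<in> copies (path_graph r) G" by (simp add: copies_def)
qed

lemma covered_path_graph_iff:
  assumes "r \<ge> 2"
  shows "covered (path_graph r) G \<longleftrightarrow>
    (\<forall>e\<in>edges G. \<exists>xs. path_in G xs \<and> length xs = r \<and> e \<in> path_edges xs)"
  unfolding covered_def copies_path_graph[OF assms] by fastforce

text \<open>What saturation asks of the pair \<^term>\<open>u\<close>, \<^term>\<open>v\<close>, expressed in the graph without the edge: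
  appending \<^term>\<open>B\<close> to \<^term>\<open>A\<close> is a long enough path once \<^term>\<open>u\<close> and \<^term>\<open>v\<close> are adjacent.\<close>

definition joined :: "nat \<Rightarrow> 'a graph \<Rightarrow> 'a \<Rightarrow> 'a \<Rightarrow> bool" where
  "joined r G u v \<longleftrightarrow> (\<exists>A B. path_in G A \<and> path_in G B \<and> set A \<inter> set B = {} \<and>
     A \<noteq> [] \<and> B \<noteq> [] \<and> last A = u \<and> hd B = v \<and> r \<le> length A + length B)"

lemma joined_sym:
  assumes "joined r G u v" shows "joined r G v u"
proof -
  obtain A B where "path_in G A" "path_in G B" "set A \<inter> set B = {}"
     "A \<noteq> []" "B \<noteq> []" "last A = u" "hd B = v" "r \<le> length A + length B"
    using assms unfolding joined_def by blast
  then show ?thesis unfolding joined_def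
    by (intro exI[of _ "rev B"] exI[of _ "rev A"]) (auto simp: last_rev hd_rev)
qed

lemma finite_copies:
  assumes "finite (verts G)" "edges G \<subseteq> [verts G]\<^bsup>2\<^esup>"
  shows "finite (copies F G)"
proof (rule finite_subset)
  show "copies F G \<subseteq> Pow (verts G) \<times> Pow (edges G)"
    by (auto simp: copies_def subgraph_def)
  have "finite (edges G)"
    using assms by (rule_tac finite_subset[OF assms(2)]) (simp add: finite_imp_finite_nsets)
  then show "finite (Pow (verts G) \<times> Pow (edges G))" using assms(1) by simp
qed

text \<open>Cutting a new copy at the added edge leaves two disjoint paths of the old graph, and two
  such paths of total length at least \<^term>\<open>r\<close> can be shortened at their far ends.\<close>

lemma semi_saturated_path_graph_iff:
  assumes r: "r \<ge> 2" and G: "finite (verts G)" "edges G \<subseteq> [verts G]\<^bsup>2\<^esup>"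
  shows "semi_saturated (path_graph r) G \<longleftrightarrow>
    (\<forall>u\<in>verts G. \<forall>v\<in>verts G. u \<noteq> v \<longrightarrow> {u, v} \<notin> edges G \<longrightarrow> joined r G u v)"
    (is "_ \<longleftrightarrow> ?J")
proof
  assume sat: "semi_saturated (path_graph r) G"
  show ?J
  proof (intro ballI impI)
    fix u v assume uv: "u \<in> verts G" "v \<in> verts G" "u \<noteq> v" "{u, v} \<notin> edges G"
    define G' where "G' = add_edge G {u, v}"
    have "card (copies (path_graph r) G) < card (copies (path_graph r) G')"
      using sat uv by (auto simp: semi_saturated_def complement_edges_def G'_def)
    then have "\<not> copies (path_graph r) G' \<subseteq> copies (path_graph r) G"
      using card_mono[OF finite_copies[OF G]] by (meson leD)
    then obtain xs where xs: "path_in G' xs" "length xs = r" "\<not> path_in G xs"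
      unfolding copies_path_graph[OF r] by blast
    have "{u, v} \<in> path_edges xs"
    proof (rule ccontr)
      assume "{u, v} \<notin> path_edges xs"
      then have "path_in G xs"
        using xs(1) path_edges_subset[OF xs(1)]
        by (auto simp: path_in_def G'_def add_edge_def path_edges_def successively_conv_nth)
      then show False using xs(3) by simp
    qed
    then obtain A B where AB: "xs = A @ B" "A \<noteq> []" "B \<noteq> []" "{u, v} = {last A, hd B}"
      by (rule path_edges_split)
    have disj: "set A \<inter> set B = {}" using xs(1) AB(1) by (auto simp: path_in_def)
    have "last A \<in> set A" "hd B \<in> set B" using AB by auto
    then have out: "\<not> {u, v} \<subseteq> set A" "\<not> {u, v} \<subseteq> set B" using AB(4) disj by auto
    have old: "path_in G C" if "path_in G' C" "\<not> {u, v} \<subseteq> set C" for C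
    proof -
      have "successively (\<lambda>x y. {x, y} \<in> edges G) C"
        by (rule successively_mono[of "\<lambda>x y. {x, y} \<in> edges G'"])
          (use that in \<open>auto simp: path_in_def G'_def add_edge_def dest: equalityD2\<close>)
      then show ?thesis using that by (auto simp: path_in_def G'_def add_edge_def)
    qed
    have "path_in G A" "path_in G B"
      using old out xs(1) unfolding AB(1) path_in_append_iff by auto
    then have "joined r G (last A) (hd B)"
      unfolding joined_def using AB(1-3) disj xs(2)
      by (intro exI[of _ A] exI[of _ B]) auto
    moreover have "(last A = u \<and> hd B = v) \<or> (last A = v \<and> hd B = u)"
      using AB(4) by (auto simp: doubleton_eq_iff)
    ultimately show "joined r G u v" by (auto dest: joined_sym)
  qed
next
  assume J: ?J
  show "semi_saturated (path_graph r) G"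
    unfolding semi_saturated_def
  proof
    fix e assume "e \<in> complement_edges G"
    then obtain u v where e: "e = {u, v}" "u \<in> verts G" "v \<in> verts G" "u \<noteq> v" "{u, v} \<notin> edges G"
      by (auto simp: complement_edges_def nsets_2_eq)
    define G' where "G' = add_edge G e"
    have GG': "verts G = verts G'" "edges G \<subseteq> edges G'" "{u, v} \<in> edges G'"
      by (auto simp: G'_def add_edge_def e(1))
    obtain A B where AB: "path_in G A" "path_in G B" "set A \<inter> set B = {}"
       "A \<noteq> []" "B \<noteq> []" "last A = u" "hd B = v" "r \<le> length A + length B"
      using J e unfolding joined_def by meson
    (* keep the last k vertices of A and the first r - k of B; the bound r - 1 leaves one for B *)
    define k where "k = min (length A) (r - 1)"
    define A' B' where "A' = drop (length A - k) A" and "B' = take (r - k) B"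
    have k: "1 \<le> k" "k \<le> length A" "k < r" "r - k \<le> length B"
      using AB(4,5,8) r by (auto simp: k_def Suc_le_eq min_def)
    have "path_in G A'"
      using AB(1) path_in_append_iff[of G "take (length A - k) A" A'] by (simp add: A'_def)
    moreover have "path_in G B'"
      using AB(2) path_in_append_iff[of G B' "drop (r - k) B"] by (simp add: B'_def)
    moreover have "set A' \<inter> set B' = {}"
      using AB(3) set_drop_subset[of "length A - k" A] set_take_subset[of "r - k" B]
      unfolding A'_def B'_def by blast
    moreover have ne: "A' \<noteq> []" "B' \<noteq> []" "last A' = u" "hd B' = v" "length A' + length B' = r"
      using k AB(4-7) by (auto simp: A'_def B'_def)
    ultimately have new: "path_in G' (A' @ B')" 
      using GG' path_in_mono[of G _ G'] by (simp add: path_in_append_iff)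
    have "e \<in> path_edges (A' @ B')" using middle_in_path_edges[OF ne(1,2)] ne(3,4) e(1) by simp
    then have "(set (A' @ B'), path_edges (A' @ B')) \<notin> copies (path_graph r) G"
      using e by (auto simp: copies_def subgraph_def)
    moreover have "(set (A' @ B'), path_edges (A' @ B')) \<in> copies (path_graph r) G'"
      unfolding copies_path_graph[OF r] using new ne(5) by (intro CollectI exI[of _ "A' @ B'"]) simp
    moreover have "copies (path_graph r) G \<subseteq> copies (path_graph r) G'"
      using GG' by (auto simp: copies_def subgraph_def)
    moreover have "finite (copies (path_graph r) G')"
      using G e by (intro finite_copies) (auto simp: G'_def add_edge_def)
    ultimately show "card (copies (path_graph r) G) < card (copies (path_graph r) (add_edge G e))"
      unfolding G'_def by (intro psubset_card_mono) auto
  qed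
qed

section \<open>Trees\<close>

definition reach :: "'a set set \<Rightarrow> ('a \<times> 'a) set" where
  "reach E = {(x, y). {x, y} \<in> E}\<^sup>*"

lemma reach_refl [simp]: "(x, x) \<in> reach E"
  by (simp add: reach_def)

lemma reach_edge: "{x, y} \<in> E \<Longrightarrow> (x, y) \<in> reach E"
  by (auto simp: reach_def)

lemma reach_trans: "(x, y) \<in> reach E \<Longrightarrow> (y, z) \<in> reach E \<Longrightarrow> (x, z) \<in> reach E"
  unfolding reach_def by (rule rtrancl_trans)

lemma reach_sym: "(x, y) \<in> reach E \<Longrightarrow> (y, x) \<in> reach E"
  unfolding reach_def
  by (rule symD[OF sym_rtrancl]) (auto simp: sym_def insert_commute)

lemma reach_subset:
  assumes "(x, y) \<in> reach E" and "\<And>a b. {a, b} \<in> E \<Longrightarrow> (a, b) \<in> reach F"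
  shows "(x, y) \<in> reach F"
  using assms(1) unfolding reach_def[of E]
  by (induction rule: rtrancl_induct) (auto intro: reach_trans assms(2))

lemma reach_mono: "(x, y) \<in> reach E \<Longrightarrow> E \<subseteq> F \<Longrightarrow> (x, y) \<in> reach F"
  by (erule reach_subset) (auto intro: reach_edge)

lemma reach_along_list:
  "successively (\<lambda>x y. {x, y} \<in> E) xs \<Longrightarrow> x \<in> set xs \<Longrightarrow> y \<in> set xs \<Longrightarrow> (x, y) \<in> reach E"
proof -
  have hd: "(hd xs, z) \<in> reach E" if "successively (\<lambda>x y. {x, y} \<in> E) xs" "z \<in> set xs" for xs z
    using that
  proof (induction xs)
    case (Cons a xs)
    show ?case
    proof (cases "z = a")
      case False
      then have "z \<in> set xs" "xs \<noteq> []" using Cons.prems by auto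
      then have "(a, hd xs) \<in> reach E" "(hd xs, z) \<in> reach E"
        using Cons by (auto simp: successively_Cons intro: reach_edge)
      then show ?thesis by (simp add: reach_trans[of a "hd xs"])
    qed simp
  qed simp
  assume "successively (\<lambda>x y. {x, y} \<in> E) xs" "x \<in> set xs" "y \<in> set xs"
  then have "(hd xs, x) \<in> reach E" "(hd xs, y) \<in> reach E" using hd by blast+
  then show ?thesis by (blast intro: reach_trans reach_sym)
qed

lemma reach_along_path:
  "path_in G xs \<Longrightarrow> x \<in> set xs \<Longrightarrow> y \<in> set xs \<Longrightarrow> (x, y) \<in> reach (edges G)"
  by (rule reach_along_list) (auto simp: path_in_def)

lemma reach_along_path_avoiding:
  assumes "path_in G xs" "u \<notin> set xs" "x \<in> set xs" "y \<in> set xs"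
  shows "(x, y) \<in> reach {e \<in> edges G. u \<notin> e}"
proof (rule reach_along_list)
  show "successively (\<lambda>x y. {x, y} \<in> {e \<in> edges G. u \<notin> e}) xs"
    by (rule successively_mono[of "\<lambda>x y. {x, y} \<in> edges G"])
      (use assms in \<open>auto simp: path_in_def\<close>)
qed (use assms in auto)

text \<open>Sending each vertex other than the root to the edge towards a neighbour closer to the root is
  injective.\<close>

lemma connected_card_le:
  assumes "finite E" and conn: "\<And>y. y \<in> V \<Longrightarrow> (x, y) \<in> reach E"
  shows "card V \<le> card E + 1"
proof -
  define R where "R = {(x, y). {x, y} \<in> E}"
  (* distance from x *)
  define d where "d y = (LEAST n. (x, y) \<in> R ^^ n)" for y
  have "\<exists>z. {z, y} \<in> E \<and> d z < d y" if y: "y \<in> V - {x}" for y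
  proof -
    have "\<exists>n. (x, y) \<in> R ^^ n"
      using conn[of y] y by (auto simp: reach_def R_def rtrancl_power)
    then have dy: "(x, y) \<in> R ^^ d y" unfolding d_def by (rule LeastI_ex)
    with y obtain m where m: "d y = Suc m" by (cases "d y") auto
    with dy obtain z where z: "(x, z) \<in> R ^^ m" "(z, y) \<in> R" by auto
    have "d z \<le> m" unfolding d_def using z(1) by (rule Least_le)
    with z(2) m show ?thesis by (auto simp: R_def)
  qed
  then obtain par where par: "\<And>y. y \<in> V - {x} \<Longrightarrow> {par y, y} \<in> E"
      "\<And>y. y \<in> V - {x} \<Longrightarrow> d (par y) < d y"
    by metis
  have "inj_on (\<lambda>y. {par y, y}) (V - {x})"
  proof (rule inj_onI)
    fix y z assume yz: "y \<in> V - {x}" "z \<in> V - {x}" "{par y, y} = {par z, z}"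
    show "y = z"
    proof (rule ccontr)
      assume "y \<noteq> z"
      then have "par y = z" "par z = y" using yz(3) by (auto simp: doubleton_eq_iff)
      then show False using par(2)[OF yz(1)] par(2)[OF yz(2)] by simp
    qed
  qed
  then have "card (V - {x}) \<le> card E"
    by (rule card_inj_on_le) (use par(1) assms(1) in auto)
  then show ?thesis by (simp add: card_Diff_singleton_if split: if_splits)
qed

text \<open>Trees are characterised by connectedness and the number of edges, because the lower bound meets
  them as the components with too few edges.\<close>

definition is_tree :: "'a graph \<Rightarrow> bool" where
  "is_tree T \<longleftrightarrow> finite (verts T) \<and> edges T \<subseteq> [verts T]\<^bsup>2\<^esup> \<and>
     (\<forall>x\<in>verts T. \<forall>y\<in>verts T. (x, y) \<in> reach (edges T)) \<and> card (edges T) < card (verts T)"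

text \<open>If \<^term>\<open>x\<close> and \<^term>\<open>y\<close> were joined around \<^term>\<open>u\<close>, there would be a cycle through \<^term>\<open>u\<close>, and
  deleting its edge \<^term>\<open>{u, x}\<close> would leave a connected graph with too few edges.\<close>

lemma tree_neighbours_separated:
  assumes T: "is_tree T" and xy: "{u, x} \<in> edges T" "{u, y} \<in> edges T" "x \<noteq> y"
  shows "(x, y) \<notin> reach {e \<in> edges T. u \<notin> e}"
proof
  assume "(x, y) \<in> reach {e \<in> edges T. u \<notin> e}"
  define F where "F = edges T - {{u, x}}"
  have finE: "finite (edges T)"
    using T unfolding is_tree_def by (meson finite_imp_finite_nsets finite_subset)
  have "edges T \<subseteq> [verts T]\<^bsup>2\<^esup>" using T by (simp add: is_tree_def)
  then have "{u, x} \<in> [verts T]\<^bsup>2\<^esup>" "{u, y} \<in> [verts T]\<^bsup>2\<^esup>" using xy by (simp_all only: subsetD)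
  then have u: "u \<in> verts T" "u \<noteq> x" "u \<noteq> y" by simp_all
  have "(x, y) \<in> reach F"
    by (rule reach_mono) (fact, auto simp: F_def)
  moreover have "(u, y) \<in> reach F"
    using xy u by (intro reach_edge) (auto simp: F_def doubleton_eq_iff)
  ultimately have ux: "(u, x) \<in> reach F" by (blast intro: reach_sym reach_trans)
  have "card (verts T) \<le> card F + 1"
  proof (rule connected_card_le)
    show "finite F" using finE by (simp add: F_def)
    fix z assume "z \<in> verts T"
    then have "(u, z) \<in> reach (edges T)" using T u by (simp add: is_tree_def)
    then show "(u, z) \<in> reach F"
    proof (rule reach_subset)
      fix a b assume ab: "{a, b} \<in> edges T"
      show "(a, b) \<in> reach F"
      proof (cases "{a, b} = {u, x}")
        case True
        then show ?thesis using ux reach_sym by (auto simp: doubleton_eq_iff)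
      next
        case False
        then show ?thesis using ab by (intro reach_edge) (simp add: F_def)
      qed
    qed
  qed
  moreover have "card F + 1 = card (edges T)"
    using card_Suc_Diff1[OF finE xy(1)] by (simp add: F_def)
  ultimately show False using T by (simp add: is_tree_def)
qed

text \<open>Deleting \<^term>\<open>u\<close> separates \<^term>\<open>X\<close> from \<^term>\<open>Y\<close>, and the rest of \<^term>\<open>A\<close> stays on one side, as does
  all of \<^term>\<open>B\<close>, which meets \<^term>\<open>Y\<close>. If \<^term>\<open>A\<close> misses \<^term>\<open>Y\<close>, it can replace \<^term>\<open>X\<close> and \<^term>\<open>u\<close> in the
  longest path, so it is not longer than they are; otherwise nothing of \<^term>\<open>A\<close> or \<^term>\<open>B\<close> lies on the
  side of \<^term>\<open>X\<close>.\<close>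

lemma longest_path_side:
  assumes T: "is_tree T" and p: "path_in T (X @ u # Y)"
    and longest: "\<And>q. path_in T q \<Longrightarrow> length q \<le> length (X @ u # Y)"
    and A: "path_in T A" "A \<noteq> []" "last A = u"
    and B: "path_in T B" "u \<notin> set B" "b \<in> set B" "b \<in> set Y"
  shows "length A \<le> Suc (length X) \<or> (set A \<union> set B) \<inter> set X = {}"
proof (rule ccontr)
  assume neg: "\<not> ?thesis"
  then obtain x where x: "x \<in> set X" "x \<in> set A \<union> set B" by auto
  define S where "S = reach {e \<in> edges T. u \<notin> e}"
  have pX: "path_in T X" "path_in T Y" "u \<notin> set X" "u \<notin> set Y"
    and uY: "path_in T (u # Y)"
    using p path_in_append_iff[of T X "u # Y"] path_in_append_iff[of T "[u]" Y] by auto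
  have ne: "X \<noteq> []" "Y \<noteq> []" using x B by auto
  have nb: "{u, last X} \<in> edges T" "{u, hd Y} \<in> edges T"
    using p ne path_in_append_iff[of T X "u # Y"] path_in_append_iff[of T "[u]" Y]
    by (auto simp: insert_commute)
  have inX: "(last X, z) \<in> S" if "z \<in> set X" for z
    unfolding S_def using pX ne that by (intro reach_along_path_avoiding) auto
  have inY: "(hd Y, z) \<in> S" if "z \<in> set Y" for z
    unfolding S_def using pX ne that by (intro reach_along_path_avoiding) auto
  have A_split: "A = butlast A @ [u]" using A by (metis append_butlast_last_id)
  then have pA: "path_in T (butlast A)" "u \<notin> set (butlast A)"
    using A(1) path_in_append_iff[of T "butlast A" "[u]"] by auto
  have "\<exists>y. y \<in> set Y \<and> (x, y) \<in> S"
  proof (cases "x \<in> set B")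
    case True
    then have "(x, b) \<in> S"
      unfolding S_def using B by (intro reach_along_path_avoiding) auto
    then show ?thesis using B by auto
  next
    case False
    have "set A \<inter> set Y \<noteq> {}"
    proof
      assume "set A \<inter> set Y = {}"
      then have "path_in T (A @ Y)"
        using A pX nb ne by (auto simp: path_in_append_iff)
      then show False using longest[of "A @ Y"] neg by auto
    qed
    then obtain y where y: "y \<in> set A" "y \<in> set Y" by auto
    have "x \<in> set A" "x \<noteq> u" "y \<noteq> u" using False x y(2) pX by auto
    moreover have "set A = insert u (set (butlast A))" by (subst A_split) simp
    ultimately have "x \<in> set (butlast A)" "y \<in> set (butlast A)" using y(1) by auto
    then have "(x, y) \<in> S"
      unfolding S_def using pA by (intro reach_along_path_avoiding) auto
    then show ?thesis using y by auto
  qed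
  then have "(last X, hd Y) \<in> S"
    using inX[OF x(1)] inY unfolding S_def by (blast intro: reach_sym reach_trans)
  moreover have "last X \<noteq> hd Y"
    using p last_in_set[OF ne(1)] hd_in_set[OF ne(2)] by (auto simp: path_in_def)
  ultimately show False
    using tree_neighbours_separated[OF T nb] by (simp add: S_def)
qed

text \<open>The test edge joins the vertices in positions \<^term>\<open>j\<close> from the two ends of a longest path. One
  end of that path, consisting of \<^term>\<open>j - 1\<close> vertices, is missed by the \<^term>\<open>r\<close> vertices of the new path.\<close>

lemma saturated_tree_large:
  assumes T: "is_tree T" and ps: "path_in T ps" "r \<le> length ps"
    and j: "1 \<le> j" "2 * j < r"
    and sat: "\<And>u v. u \<in> verts T \<Longrightarrow> v \<in> verts T \<Longrightarrow> u \<noteq> v \<Longrightarrow> {u, v} \<notin> edges T \<Longrightarrow> joined r T u v"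
  shows "r + j - 1 \<le> card (verts T)"
proof -
  have fin: "finite (verts T)" using T by (simp add: is_tree_def)
  have bound: "length q \<le> card (verts T)" if "path_in T q" for q
    using that card_mono[OF fin, of "set q"] by (simp add: path_in_def distinct_card)
  obtain p where p: "path_in T p" and longest: "\<And>q. path_in T q \<Longrightarrow> length q \<le> length p"
    using ex_has_greatest_nat[of "path_in T" ps length "Suc (card (verts T))"] ps(1) bound
    by (metis le_imp_less_Suc)
  define L where "L = length p"
  have L: "2 * j < L" using longest[OF ps(1)] ps(2) j by (simp add: L_def)
  (* p = X @ u # M @ v # Y, where X and Y have j - 1 vertices each and M is nonempty *)
  define X M Y where "X = take (j - 1) p" and "M = take (L - 2 * j) (drop j p)" and "Y = drop (L - j + 1) p"
  define u v where "u = p ! (j - 1)" and "v = p ! (L - j)"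
  have lens: "length X = j - 1" "length Y = j - 1" "M \<noteq> []"
    using L j by (auto simp: X_def Y_def M_def L_def)
  have "p = take (j - 1) p @ p ! (j - 1) # drop j p"
    using id_take_nth_drop[of "j - 1" p] L j by (simp add: L_def)
  moreover have "drop j p = take (L - 2 * j) (drop j p) @ p ! (L - j) # drop (L - j + 1) p"
    using id_take_nth_drop[of "L - 2 * j" "drop j p"] L j by (simp add: L_def)
  ultimately have p_eq: "p = X @ u # M @ v # Y"
    unfolding X_def M_def Y_def u_def v_def by simp
  have dist: "distinct (X @ u # M @ v # Y)" and sub: "set (X @ u # M @ v # Y) \<subseteq> verts T"
    using p unfolding p_eq path_in_def by auto
  have uv: "u \<in> verts T" "v \<in> verts T" "u \<noteq> v" using dist sub by auto
  have tail: "path_in T (u # M @ v # Y)"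
    using p path_in_append_iff[of T X] unfolding p_eq by blast
  have "{u, v} \<notin> edges T"
  proof
    assume e: "{u, v} \<in> edges T"
    have Mv: "path_in T (M @ v # Y)" and uM: "{u, hd M} \<in> edges T"
      using tail lens(3) path_in_append_iff[of T "[u]" "M @ v # Y"] by auto
    have "(hd M, v) \<in> reach {e \<in> edges T. u \<notin> e}"
      using Mv dist lens(3) by (intro reach_along_path_avoiding[of T "M @ v # Y"]) auto
    moreover have "hd M \<noteq> v" using dist lens(3) by auto
    ultimately show False using tree_neighbours_separated[OF T uM e] by blast
  qed
  then obtain A B where AB: "path_in T A" "path_in T B" "set A \<inter> set B = {}"
     "A \<noteq> []" "B \<noteq> []" "last A = u" "hd B = v" "r \<le> length A + length B"
    using sat uv unfolding joined_def by meson
  have v_B: "v \<in> set B" "u \<in> set A" using AB by auto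
  then have u_B: "u \<notin> set B" "v \<notin> set A" using AB(3) by auto
  have left: "length A \<le> j \<or> (set A \<union> set B) \<inter> set X = {}"
    using longest_path_side[OF T, of X u "M @ v # Y" A B v] p longest AB v_B u_B lens(1) j(1)
    unfolding p_eq by simp
  have rev_p: "rev p = rev Y @ v # rev M @ u # rev X" by (simp add: p_eq)
  (* the same argument for the reversed path, with the roles of A and B exchanged *)
  have "length (rev B) \<le> Suc (length (rev Y)) \<or> (set (rev B) \<union> set (rev A)) \<inter> set (rev Y) = {}"
  proof (rule longest_path_side[OF T])
    show "path_in T (rev Y @ v # rev M @ u # rev X)"
      using p path_in_rev[of T p] unfolding rev_p by simp
    show "length q \<le> length (rev Y @ v # rev M @ u # rev X)" if "path_in T q" for q
      using longest[OF that] by (simp add: p_eq)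
    show "last (rev B) = v" using AB by (simp add: last_rev)
  qed (use AB u_B v_B in auto)
  then have right: "length B \<le> j \<or> (set A \<union> set B) \<inter> set Y = {}"
    using lens j by auto
  (* not both A and B are short, because 2 * j < r; Z is an end of p that they avoid *)
  obtain Z where Z: "(set A \<union> set B) \<inter> set Z = {}" "length Z = j - 1" "distinct Z" "set Z \<subseteq> verts T"
  proof (cases "length A \<le> j")
    case True
    then have "(set A \<union> set B) \<inter> set Y = {}" using right AB(8) j(2) by linarith
    then show thesis using that[of Y] lens dist sub by simp
  next
    case False
    then have "(set A \<union> set B) \<inter> set X = {}" using left by blast
    then show thesis using that[of X] lens dist sub by simp
  qed
  have dAB: "distinct (A @ B)" "set (A @ B) \<subseteq> verts T"
    using AB by (auto simp: path_in_def)
  then have "distinct (A @ B @ Z)" "set (A @ B @ Z) \<subseteq> verts T"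
    using Z by auto
  then have "length (A @ B @ Z) \<le> card (verts T)"
    using card_mono[OF fin, of "set (A @ B @ Z)"] by (simp only: distinct_card)
  then show ?thesis using AB(8) Z(2) by simp
qed

section \<open>The lower bound\<close>

definition component :: "'a graph \<Rightarrow> 'a \<Rightarrow> 'a graph" where
  "component G x = (reach (edges G) `` {x}, edges G \<inter> Pow (reach (edges G) `` {x}))"

lemma edge_in_component:
  assumes "{a, b} \<in> edges G" "a \<in> verts (component G x)"
  shows "b \<in> verts (component G x)" "{a, b} \<in> edges (component G x)"
  using assms by (auto simp: component_def intro: reach_trans reach_edge)

text \<open>A path that meets a component lies in it, so that components inherit coverage and
  saturation.\<close>

lemma path_in_component:
  assumes "path_in G xs" "a \<in> set xs" "a \<in> verts (component G x)"
  shows "path_in (component G x) xs"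
proof -
  have sub: "set xs \<subseteq> verts (component G x)"
    using assms reach_along_path[OF assms(1,2)] by (auto simp: component_def intro: reach_trans)
  have "successively (\<lambda>y z. {y, z} \<in> edges (component G x)) xs"
  proof (rule successively_mono)
    show "successively (\<lambda>y z. {y, z} \<in> edges G) xs" using assms(1) by (simp add: path_in_def)
    show "{y, z} \<in> edges (component G x)" if "y \<in> set xs" "{y, z} \<in> edges G" for y z
      using that sub by (intro edge_in_component(2)) auto
  qed
  then show ?thesis using assms(1) sub by (simp add: path_in_def)
qed

lemma component_connected:
  assumes "a \<in> verts (component G x)" "b \<in> verts (component G x)"
  shows "(a, b) \<in> reach (edges (component G x))"
proof -
  have "(x, y) \<in> reach (edges (component G x))" if "(x, y) \<in> reach (edges G)" for y
    using that unfolding reach_def[of "edges G"]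
  proof (induction rule: rtrancl_induct)
    case (step y z)
    have "y \<in> verts (component G x)" using step(1) by (simp add: component_def reach_def)
    then have "{y, z} \<in> edges (component G x)" using step(2) by (intro edge_in_component(2)) auto
    from step(3) reach_edge[OF this] show ?case by (rule reach_trans)
  qed simp
  then have "(x, a) \<in> reach (edges (component G x))" "(x, b) \<in> reach (edges (component G x))"
    using assms by (simp_all add: component_def)
  from reach_sym[OF this(1)] this(2) show ?thesis by (rule reach_trans)
qed

lemma component_verts_subset:
  assumes "x \<in> \<Union> (edges G)"
  shows "verts (component G x) \<subseteq> \<Union> (edges G)"
  using assms unfolding component_def reach_def by (auto elim: rtranclE)

lemma component_eq:
  assumes "z \<in> verts (component G x)"
  shows "component G z = component G x"
proof -
  have "(x, z) \<in> reach (edges G)" using assms by (simp add: component_def)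
  then have "(z, y) \<in> reach (edges G) \<longleftrightarrow> (x, y) \<in> reach (edges G)" for y
    by (meson reach_sym reach_trans)
  then show ?thesis by (simp add: component_def Image_singleton)
qed

text \<open>The union of \<^term>\<open>edges G\<close> is the set of the vertices that are not isolated.\<close>

lemma edge_density_from_components:
  fixes a b :: nat
  assumes fin: "finite (verts G)" "edges G \<subseteq> [verts G]\<^bsup>2\<^esup>"
    and dens: "\<And>x. x \<in> \<Union> (edges G) \<Longrightarrow>
       a * card (verts (component G x)) \<le> b * card (edges (component G x))"
  shows "a * card (\<Union> (edges G)) \<le> b * card (edges G)"
proof -
  define Q where "Q = component G ` \<Union> (edges G)"
  have sub: "\<Union> (edges G) \<subseteq> verts G" using fin by (auto simp: nsets_def)
  have finU: "finite (\<Union> (edges G))" using finite_subset[OF sub fin(1)] .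
  have finE: "finite (edges G)"
    using fin by (meson finite_imp_finite_nsets finite_subset)
  have disj: "verts C \<inter> verts D = {}" if "C \<in> Q" "D \<in> Q" "C \<noteq> D" for C D
  proof (rule ccontr)
    assume "verts C \<inter> verts D \<noteq> {}"
    then obtain z where z: "z \<in> verts C" "z \<in> verts D" by blast
    have "component G z = C'" if "C' \<in> Q" "z \<in> verts C'" for C'
      using that component_eq unfolding Q_def by fastforce
    from this[OF that(1) z(1)] this[OF that(2) z(2)] show False using that(3) by simp
  qed
  have finQ: "finite Q" using finU by (simp add: Q_def)
  have subV: "verts C \<subseteq> \<Union> (edges G)" if "C \<in> Q" for C
    using that component_verts_subset[of _ G] unfolding Q_def by (elim imageE) simp
  then have finV: "finite (verts C)" if "C \<in> Q" for C
    using that finite_subset[OF _ finU] by simp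
  have ne: "e \<noteq> {}" if "e \<in> edges G" for e using that fin by (auto simp: nsets_def)
  have inE: "edges C \<subseteq> edges G \<inter> Pow (verts C)" if "C \<in> Q" for C
    using that by (auto simp: Q_def component_def)
  have self: "x \<in> verts (component G x)" for x by (simp add: component_def)
  have "\<Union> (edges G) = (\<Union>C\<in>Q. verts C)"
  proof
    show "\<Union> (edges G) \<subseteq> (\<Union>C\<in>Q. verts C)" using self by (auto simp: Q_def)
  qed (use subV in blast)
  then have 1: "card (\<Union> (edges G)) = (\<Sum>C\<in>Q. card (verts C))"
    using card_UN_disjoint[of Q verts] finQ finV disj by simp
  have "edges G = (\<Union>C\<in>Q. edges C)"
  proof
    show "edges G \<subseteq> (\<Union>C\<in>Q. edges C)"
    proof
      fix e assume e: "e \<in> edges G"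
      then have "e \<in> [verts G]\<^bsup>2\<^esup>" using fin(2) by blast
      then obtain x y where xy: "e = {x, y}" by (auto simp: nsets_2_eq)
      then have "e \<in> edges (component G x)" using e self by (simp add: edge_in_component(2))
      moreover have "component G x \<in> Q" using e xy by (auto simp: Q_def)
      ultimately show "e \<in> (\<Union>C\<in>Q. edges C)" by blast
    qed
  qed (use inE in blast)
  moreover have "edges C \<inter> edges D = {}" if "C \<in> Q" "D \<in> Q" "C \<noteq> D" for C D
    using inE[OF that(1)] inE[OF that(2)] disj[OF that] ne by blast
  moreover have "finite (edges C)" if "C \<in> Q" for C
    using inE[OF that] finE by (meson finite_subset le_infE)
  ultimately have 2: "card (edges G) = (\<Sum>C\<in>Q. card (edges C))"
    using card_UN_disjoint[of Q edges] finQ by simp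
  have "a * card (verts C) \<le> b * card (edges C)" if "C \<in> Q" for C
    using that dens unfolding Q_def by (elim imageE) simp
  then show ?thesis unfolding 1 2 sum_distrib_left by (rule sum_mono)
qed

text \<open>A component with an edge has at least \<open>(s - 1) / s\<close> edges per vertex: either it has at least
  as many edges as vertices, or it is a tree with at least \<^term>\<open>s\<close> vertices. The subtraction of \<open>1\<close> from
  the number of vertices accounts for a possible isolated vertex.\<close>

lemma cov_sat_edges_lower:
  assumes r: "3 \<le> r" and j: "1 \<le> j" "2 * j < r" and G: "is_graph G" "cov_sat (path_graph r) G"
  defines "s \<equiv> r + j - 1"
  shows "(s - 1) * (card (verts G) - 1) \<le> s * card (edges G)"
proof -
  have fin: "finite (verts G)" "edges G \<subseteq> [verts G]\<^bsup>2\<^esup>" using G by (auto simp: is_graph_def)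
  have r2: "2 \<le> r" using r by simp
  have sat: "joined r G u v" if "u \<in> verts G" "v \<in> verts G" "u \<noteq> v" "{u, v} \<notin> edges G" for u v
    using G(2) semi_saturated_path_graph_iff[OF r2 fin] that by (simp add: cov_sat_def)
  have cov: "\<exists>xs. path_in G xs \<and> length xs = r \<and> e \<in> path_edges xs" if "e \<in> edges G" for e
    using G(2) covered_path_graph_iff[OF r2, of G] that by (simp add: cov_sat_def)
  have sub: "\<Union> (edges G) \<subseteq> verts G" using fin by (auto simp: nsets_def)
  have "(s - 1) * card (verts C) \<le> s * card (edges C)"
    if x: "x \<in> \<Union> (edges G)" and C: "C = component G x" for x C
  proof (cases "card (edges C) < card (verts C)")
    case True
    have CG: "verts C \<subseteq> verts G" using component_verts_subset[OF x] sub C by auto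
    have xC: "x \<in> verts C" by (simp add: C component_def)
    have tree: "is_tree C"
      using True fin CG component_connected[of _ G x] finite_subset[OF CG]
      unfolding is_tree_def C by (auto simp: component_def nsets_def)
    obtain e where e: "e \<in> edges G" "x \<in> e" using x by auto
    then obtain xs where xs: "path_in G xs" "length xs = r" "e \<in> path_edges xs" using cov by meson
    then have "x \<in> set xs" using e(2) by (auto simp: path_edges_def)
    then have xsC: "path_in C xs" using path_in_component[OF xs(1)] xC unfolding C by simp
    have "s \<le> card (verts C)"
      unfolding s_def
    proof (rule saturated_tree_large[OF tree xsC _ j])
      fix u v assume uv: "u \<in> verts C" "v \<in> verts C" "u \<noteq> v" "{u, v} \<notin> edges C"
      then have "{u, v} \<notin> edges G" using edge_in_component(2)[of u v G x] unfolding C by auto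
      then have "joined r G u v" using sat uv CG by blast
      then obtain A B where AB: "path_in G A" "path_in G B" "set A \<inter> set B = {}"
          "A \<noteq> []" "B \<noteq> []" "last A = u" "hd B = v" "r \<le> length A + length B"
        unfolding joined_def by blast
      have "path_in C A" "path_in C B"
        using AB uv last_in_set[of A] hd_in_set[of B]
          path_in_component[of G A u x] path_in_component[of G B v x] unfolding C by auto
      then show "joined r C u v" using AB unfolding joined_def by blast
    qed (use xs in simp)
    moreover have "card (verts C) \<le> card (edges C) + 1"
    proof (rule connected_card_le)
      show "finite (edges C)"
        using tree unfolding is_tree_def by (meson finite_imp_finite_nsets finite_subset)
      show "(x, y) \<in> reach (edges C)" if "y \<in> verts C" for y
        using component_connected[of x G x y] that xC unfolding C by simp
    qed
    moreover have "(s - 1) * card (verts C) + card (verts C) = s * card (verts C)"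
      using r by (cases s) (auto simp: s_def)
    moreover have "s * card (verts C) \<le> s * card (edges C) + s"
      using mult_le_mono2[of "card (verts C)" "card (edges C) + 1" s] calculation(2) by simp
    ultimately show ?thesis by linarith
  qed (auto intro: mult_le_mono)
  then have main: "(s - 1) * card (\<Union> (edges G)) \<le> s * card (edges G)"
    using edge_density_from_components[OF fin] by blast
  (* two isolated vertices: the new path through them consists of the added edge alone *)
  have iso: "u = v" if uv: "u \<in> verts G - \<Union> (edges G)" "v \<in> verts G - \<Union> (edges G)" for u v
  proof (rule ccontr)
    assume "u \<noteq> v"
    moreover have "{u, v} \<notin> edges G" using uv by auto
    ultimately obtain A B where AB: "path_in G A" "path_in G B"
       "A \<noteq> []" "B \<noteq> []" "last A = u" "hd B = v" "r \<le> length A + length B"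
      using sat[of u v] uv unfolding joined_def by auto
    have "length A \<le> 1"
    proof (rule ccontr)
      assume "\<not> length A \<le> 1"
      then have "{A ! (length A - 2), A ! (length A - 1)} \<in> edges G"
        using AB(1) by (auto simp: path_in_def successively_conv_nth Suc_diff_Suc numeral_2_eq_2
            dest!: spec[of _ "length A - 2"])
      then show False using AB(3,5) uv by (auto simp: last_conv_nth)
    qed
    moreover have "length B \<le> 1"
    proof (rule ccontr)
      assume "\<not> length B \<le> 1"
      then have "{B ! 0, B ! 1} \<in> edges G"
        using AB(2) by (auto simp: path_in_def successively_conv_nth dest!: spec[of _ 0])
      then show False using AB(4,6) uv by (auto simp: hd_conv_nth)
    qed
    ultimately show False using AB r by simp
  qed
  have "card (verts G - \<Union> (edges G)) \<le> 1"
    using iso fin(1) by (simp add: card_le_Suc0_iff_eq)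
  then have "card (verts G) - 1 \<le> card (\<Union> (edges G))"
    using card_Diff_subset[OF finite_subset[OF sub fin(1)] sub] by linarith
  then have "(s - 1) * (card (verts G) - 1) \<le> (s - 1) * card (\<Union> (edges G))"
    by (rule mult_le_mono2)
  then show ?thesis using main by linarith
qed

section \<open>The upper bound\<close>

text \<open>The vertices below \<^term>\<open>n\<close> are cut into blocks of \<^term>\<open>s\<close> consecutive numbers; the remainder joins
  the last block, so that every block has at least \<^term>\<open>s\<close> elements.\<close>

definition block :: "nat \<Rightarrow> nat \<Rightarrow> nat \<Rightarrow> nat" where
  "block s n x = min (x div s) (n div s - 1)"

definition path_forest :: "nat \<Rightarrow> nat \<Rightarrow> nat graph" where
  "path_forest s n = ({..<n}, {{i, Suc i} | i. Suc i < n \<and> block s n i = block s n (Suc i)})"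

lemma block_interval:
  assumes "0 < s" "s \<le> n" "x < n"
  obtains a b where "a \<le> x" "x < b" "b \<le> n" "a + s \<le> b"
    "\<And>y. y \<in> {a..<b} \<longleftrightarrow> y < n \<and> block s n y = block s n x"
proof -
  define q where "q = n div s - 1"
  have "n div s \<ge> 1" using assms by (simp add: div_greater_zero_iff Suc_le_eq)
  then have q: "n div s = Suc q" by (simp add: q_def)
  have qn: "s * Suc q \<le> n" "n < s * Suc (Suc q)"
    using q assms by (metis times_div_less_eq_dividend) (metis q assms(1) dividend_less_times_div mult_Suc_right add.commute)
  show thesis
  proof (cases "x div s < q")
    case True
    define k where "k = x div s"
    have k: "s * k \<le> x" "x < s * k + s"
      using assms(1) dividend_less_times_div[of s x] by (auto simp: k_def)
    have "s * Suc k \<le> s * q" using True by (intro mult_le_mono2) (simp add: k_def)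
    then have kn: "s * k + s \<le> n" using qn by simp
    show thesis
    proof (rule that)
      show "y \<in> {s * k..<s * k + s} \<longleftrightarrow> y < n \<and> block s n y = block s n x" for y
      proof -
        have "y \<in> {s * k..<s * k + s} \<longleftrightarrow> y div s = k"
          using assms(1) dividend_less_times_div[of s y] by (auto simp: div_nat_eqI algebra_simps)
        then show ?thesis using True kn by (auto simp: block_def q k_def min_def)
      qed
    qed (use k kn in auto)
  next
    case False
    show thesis
    proof (rule that)
      have *: "q \<le> y div s \<longleftrightarrow> s * q \<le> y" for y
        using assms(1) by (simp add: less_eq_div_iff_mult_less_eq mult.commute)
      show "s * q \<le> x" using False *[of x] by linarith
      show "y \<in> {s * q..<n} \<longleftrightarrow> y < n \<and> block s n y = block s n x" for y
        using False *[of y] by (auto simp: block_def q min_def)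
    qed (use assms qn in auto)
  qed
qed

lemma path_forest_interval_path:
  assumes "0 < s" "s \<le> n" and "\<And>y. y \<in> {a..<b} \<longleftrightarrow> y < n \<and> block s n y = c" "a \<le> i" "k \<le> b"
  shows "path_in (path_forest s n) [i..<k]"
proof -
  have "set [i..<k] \<subseteq> {a..<b}" using assms by auto
  then have *: "y < n \<and> block s n y = c" if "y \<in> set [i..<k]" for y using assms(3) that by blast
  have "{y, Suc y} \<in> edges (path_forest s n)" if "y \<in> set [i..<k]" "Suc y \<in> set [i..<k]" for y
    using *[OF that(1)] *[OF that(2)] by (auto simp: path_forest_def)
  then have "successively (\<lambda>x y. {x, y} \<in> edges (path_forest s n)) [i..<k]"
    by (auto simp: successively_conv_nth)
  then show ?thesis using * by (auto simp: path_in_def path_forest_def)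
qed

text \<open>Two vertices of one block at distance \<open>d\<close> in a path on \<open>L\<close> vertices offer three new paths: the
  one that cuts off the vertices between them, and the two that also run back through these vertices
  but give up one end. Their lengths add up to \<open>2 * L + 2\<close>, so one of them has at least
  \<open>(2 * L + 2) / 3\<close> vertices, which exceeds \<open>r - 1\<close>. In different blocks, each vertex is the end of a
  path in its block with more than \<open>s / 2\<close> vertices.\<close>

lemma path_forest_joined:
  assumes s: "0 < s" "s \<le> n" "r \<le> s" "3 * r \<le> 2 * s + 4"
    and xy: "x < y" "y < n" "{x, y} \<notin> edges (path_forest s n)"
  shows "joined r (path_forest s n) x y"
proof -
  note path = path_forest_interval_path[OF s(1,2)]
  have "x < n" using xy by simp
  then obtain a b where ab: "a \<le> x" "x < b" "b \<le> n" "a + s \<le> b"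
      and ab_iff: "\<And>z. z \<in> {a..<b} \<longleftrightarrow> z < n \<and> block s n z = block s n x"
    using block_interval[OF s(1,2)] by metis
  have left: "path_in (path_forest s n) [a..<Suc x]" using path[OF ab_iff] ab by (simp del: upt_Suc)
  show ?thesis
  proof (cases "block s n x = block s n y")
    case True
    then have "y \<in> {a..<b}" using ab_iff xy(2) by simp
    then have y: "y < b" by simp
    have "y \<noteq> Suc x" using xy True by (auto simp: path_forest_def)
    then have gap: "Suc x < y" using xy(1) by simp
    have right: "path_in (path_forest s n) [y..<b]" using path[OF ab_iff] ab xy(1) by (simp del: upt_Suc)
    consider "r \<le> (Suc x - a) + (b - y)" | "r \<le> (Suc x - a) + (y - x)" | "r \<le> (y - x) + (b - y)"
      using s ab gap y by linarith
    then show ?thesis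
    proof cases
      case 1
      then show ?thesis unfolding joined_def using left right ab y gap
        by (intro exI[of _ "[a..<Suc x]"] exI[of _ "[y..<b]"]) (auto simp del: upt_Suc)
    next
      case 2
      have "path_in (path_forest s n) [Suc x..<Suc y]" using path[OF ab_iff] ab y by (simp del: upt_Suc)
      then have "path_in (path_forest s n) (rev [Suc x..<Suc y])" by (simp only: path_in_rev)
      then show ?thesis unfolding joined_def using left ab y gap 2
        by (intro exI[of _ "[a..<Suc x]"] exI[of _ "rev [Suc x..<Suc y]"]) (auto simp: hd_rev simp del: upt_Suc)
    next
      case 3
      have "path_in (path_forest s n) [x..<y]" using path[OF ab_iff] ab y by (simp del: upt_Suc)
      then have "path_in (path_forest s n) (rev [x..<y])" by (simp only: path_in_rev)
      then show ?thesis unfolding joined_def using right ab y gap 3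
        by (intro exI[of _ "rev [x..<y]"] exI[of _ "[y..<b]"]) (auto simp: last_rev simp del: upt_Suc)
    qed
  next
    case False
    obtain c d where cd: "c \<le> y" "y < d" "d \<le> n" "c + s \<le> d"
        and cd_iff: "\<And>z. z \<in> {c..<d} \<longleftrightarrow> z < n \<and> block s n z = block s n y"
      using block_interval[OF s(1,2) xy(2)] by metis
    have "z \<notin> {c..<d}" if "z \<in> {a..<b}" for z
      using that False unfolding ab_iff cd_iff by simp
    then have disj: "{a..<b} \<inter> {c..<d} = {}" by blast
    have "\<exists>A. path_in (path_forest s n) A \<and> A \<noteq> [] \<and> last A = x \<and> set A \<subseteq> {a..<b} \<and> s + 1 \<le> 2 * length A"
    proof (cases "s + 1 \<le> 2 * (Suc x - a)")
      case True
      then show ?thesis using left ab by (intro exI[of _ "[a..<Suc x]"]) (auto simp del: upt_Suc)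
    next
      case False
      have "path_in (path_forest s n) [x..<b]" using path[OF ab_iff] ab by (simp del: upt_Suc)
      then have "path_in (path_forest s n) (rev [x..<b])" by (simp only: path_in_rev)
      then show ?thesis using ab False by (intro exI[of _ "rev [x..<b]"]) (auto simp: last_rev simp del: upt_Suc)
    qed
    then obtain A where A: "path_in (path_forest s n) A" "A \<noteq> []" "last A = x" "set A \<subseteq> {a..<b}"
        "s + 1 \<le> 2 * length A" by blast
    have "\<exists>B. path_in (path_forest s n) B \<and> B \<noteq> [] \<and> hd B = y \<and> set B \<subseteq> {c..<d} \<and> s + 1 \<le> 2 * length B"
    proof (cases "s + 1 \<le> 2 * (d - y)")
      case True
      have "path_in (path_forest s n) [y..<d]" using path[OF cd_iff] cd by (simp del: upt_Suc)
      then show ?thesis using True cd by (intro exI[of _ "[y..<d]"]) (auto simp del: upt_Suc)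
    next
      case False
      have "path_in (path_forest s n) [c..<Suc y]" using path[OF cd_iff] cd by (simp del: upt_Suc)
      then have "path_in (path_forest s n) (rev [c..<Suc y])" by (simp only: path_in_rev)
      then show ?thesis using cd False by (intro exI[of _ "rev [c..<Suc y]"]) (auto simp: hd_rev simp del: upt_Suc)
    qed
    then obtain B where B: "path_in (path_forest s n) B" "B \<noteq> []" "hd B = y" "set B \<subseteq> {c..<d}"
        "s + 1 \<le> 2 * length B" by blast
    have "set A \<inter> set B = {}" using A(4) B(4) disj by blast
    moreover have "r \<le> length A + length B" using A(5) B(5) s(3) by linarith
    ultimately show ?thesis unfolding joined_def using A B by blast
  qed
qed

text \<open>Each block contributes one vertex, its last one, that has no edge to its successor.\<close>

lemma card_edges_path_forest:
  assumes "0 < s" "s \<le> n"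
  shows "card (edges (path_forest s n)) \<le> n - n div s"
proof -
  define q where "q = n div s - 1"
  have "n div s \<ge> 1" using assms by (simp add: div_greater_zero_iff Suc_le_eq)
  then have q: "n div s = Suc q" by (simp add: q_def)
  have "s * Suc q \<le> n" using q times_div_less_eq_dividend[of s n] by simp
  then have qn: "s * q + s \<le> n" by simp
  define D where "D = (\<lambda>k. s * k + (s - 1)) ` {..<q}"
  have D_less: "i < n - 1" if iD: "i \<in> D" for i
  proof -
    obtain k where k: "k < q" "i = s * k + (s - 1)" using iD by (auto simp: D_def)
    have "s * Suc k \<le> s * q" using k by (intro mult_le_mono2) simp
    then show ?thesis using k qn assms by simp
  qed
  have "inj_on (\<lambda>k. s * k + (s - 1)) {..<q}"
  proof (rule inj_onI)
    fix x y assume "s * x + (s - 1) = s * y + (s - 1)"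
    then have "s * x = s * y" by linarith
    then show "x = y" using assms by simp
  qed
  then have "card D = q" by (simp add: D_def card_image)
  moreover have "n - 1 \<notin> D" "finite D" using D_less by (auto simp: D_def)
  ultimately have cardD: "card (insert (n - 1) D) = n div s" using q by simp
  have "edges (path_forest s n) \<subseteq> (\<lambda>i. {i, Suc i}) ` ({..<n} - insert (n - 1) D)"
  proof
    fix e assume "e \<in> edges (path_forest s n)"
    then obtain i where i: "e = {i, Suc i}" "Suc i < n" "block s n i = block s n (Suc i)"
      by (auto simp: path_forest_def)
    have "i \<notin> D"
    proof
      assume "i \<in> D"
      then obtain k where k: "k < q" "i = s * k + (s - 1)" by (auto simp: D_def)
      then have "Suc i = s * Suc k" "i div s = k" using assms by (simp, intro div_nat_eqI) auto
      then have "block s n i = k" "block s n (Suc i) = Suc k"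
        using k q assms by (auto simp: block_def simp del: mult_Suc_right)
      then show False using i(3) by simp
    qed
    then show "e \<in> (\<lambda>i. {i, Suc i}) ` ({..<n} - insert (n - 1) D)" using i by auto
  qed
  then have "card (edges (path_forest s n)) \<le> card ({..<n} - insert (n - 1) D)"
    by (rule surj_card_le[rotated]) simp
  also have "\<dots> = n - n div s"
    using D_less assms \<open>finite D\<close> cardD by (subst card_Diff_subset) force+
  finally show ?thesis .
qed

lemma path_forest_cov_sat:
  assumes r: "3 \<le> r" and s: "s \<le> n" "r \<le> s" "3 * r \<le> 2 * s + 4"
  shows "is_graph (path_forest s n)" "cov_sat (path_graph r) (path_forest s n)"
proof -
  have s0: "0 < s" and r2: "2 \<le> r" using r s by auto
  have "block s n 0 = block s n (Suc 0)" using r s by (simp add: block_def)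
  then have "{0, Suc 0} \<in> edges (path_forest s n)" using r s by (auto simp: path_forest_def)
  moreover have sub: "edges (path_forest s n) \<subseteq> [verts (path_forest s n)]\<^bsup>2\<^esup>"
    by (auto simp: path_forest_def)
  moreover have fin: "finite (verts (path_forest s n))" by (simp add: path_forest_def)
  ultimately show "is_graph (path_forest s n)" by (auto simp: is_graph_def)
  have "covered (path_graph r) (path_forest s n)"
    unfolding covered_path_graph_iff[OF r2]
  proof
    fix e assume "e \<in> edges (path_forest s n)"
    then obtain i where i: "e = {i, Suc i}" "Suc i < n" "block s n i = block s n (Suc i)"
      by (auto simp: path_forest_def)
    obtain a b where ab: "a \<le> i" "i < b" "b \<le> n" "a + s \<le> b"
        and ab_iff: "\<And>z. z \<in> {a..<b} \<longleftrightarrow> z < n \<and> block s n z = block s n i"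
      using block_interval[OF s0 s(1), of i] i(2) by (metis Suc_lessD)
    have "Suc i \<in> {a..<b}" using ab_iff i by simp
    then have ib: "Suc i < b" by simp
    (* the window of r vertices starts at i unless it would run over the end of the block *)
    define t where "t = min i (b - r)"
    have t: "a \<le> t" "t \<le> i" "Suc i < t + r" "t + r \<le> b"
      using ab ib s r by (auto simp: t_def min_def)
    have "path_in (path_forest s n) [t..<t + r]"
      using path_forest_interval_path[OF s0 s(1) ab_iff] t by (simp del: upt_Suc)
    moreover have "e \<in> path_edges [t..<t + r]"
      using t i(1) by (auto simp: path_edges_def intro!: exI[of _ "i - t"] simp del: upt_Suc)
    ultimately show "\<exists>xs. path_in (path_forest s n) xs \<and> length xs = r \<and> e \<in> path_edges xs"
      by (intro exI[of _ "[t..<t + r]"]) simp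
  qed
  moreover have "semi_saturated (path_graph r) (path_forest s n)"
    unfolding semi_saturated_path_graph_iff[OF r2 fin sub]
  proof (intro ballI impI)
    fix x y assume xy: "x \<in> verts (path_forest s n)" "y \<in> verts (path_forest s n)" "x \<noteq> y"
      "{x, y} \<notin> edges (path_forest s n)"
    then have "x < n" "y < n" by (auto simp: path_forest_def)
    moreover have "x < y \<or> y < x" using xy(3) by auto
    ultimately show "joined r (path_forest s n) x y"
      using path_forest_joined[OF s0 s, of x y] path_forest_joined[OF s0 s, of y x] xy(4)
      by (auto simp: insert_commute joined_sym)
  qed
  ultimately show "cov_sat (path_graph r) (path_forest s n)" by (simp add: cov_sat_def)
qed

section \<open>The limit\<close>

lemma csat_path_graph_bounds:
  assumes r: "3 \<le> r" and j: "1 \<le> j" "2 * j < r" "r \<le> 2 * j + 2"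
  defines "s \<equiv> r + j - 1"
  assumes n: "s \<le> n"
  shows "csat n (path_graph r) \<le> n - n div s"
    and "(s - 1) * (n - 1) \<le> s * csat n (path_graph r)"
proof -
  let ?P = "\<lambda>m. \<exists>G :: nat graph. is_graph G \<and> card (verts G) = n \<and> cov_sat (path_graph r) G \<and>
    card (edges G) = m"
  have s: "0 < s" "r \<le> s" "3 * r \<le> 2 * s + 4" using r j by (auto simp: s_def)
  have ex: "?P (card (edges (path_forest s n)))"
    using path_forest_cov_sat[OF r n s(2,3)] by (intro exI[of _ "path_forest s n"]) (simp add: path_forest_def)
  then have "csat n (path_graph r) \<le> card (edges (path_forest s n))"
    unfolding csat_def by (rule Least_le)
  also have "\<dots> \<le> n - n div s" using s(1) n by (rule card_edges_path_forest)
  finally show "csat n (path_graph r) \<le> n - n div s" .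
  have "?P (csat n (path_graph r))"
    unfolding csat_def using ex by (rule LeastI)
  then show "(s - 1) * (n - 1) \<le> s * csat n (path_graph r)"
    using cov_sat_edges_lower[OF r j(1,2)] unfolding s_def by metis
qed

lemma csat_ratio_path_graph_tendsto:
  assumes r: "3 \<le> r" and j: "1 \<le> j" "2 * j < r" "r \<le> 2 * j + 2"
  shows "csat_ratio (path_graph r) \<longlonglongrightarrow> 1 - 1 / real (r + j - 1)"
proof -
  define s where "s = r + j - 1"
  have s: "0 < s" "0 < real s" using r by (auto simp: s_def)
  have lower: "(1 - 1 / real s) * (1 - 1 / real n) \<le> csat_ratio (path_graph r) n"
    and upper: "csat_ratio (path_graph r) n \<le> 1 - 1 / real s + 1 / real n" if n: "s \<le> n" for n
  proof -
    define c where "c = csat n (path_graph r)"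
    have n0: "0 < real n" using n s by simp
    have c: "c \<le> n - n div s" "(s - 1) * (n - 1) \<le> s * c"
      using csat_path_graph_bounds[OF r j] n unfolding c_def s_def by simp_all
    have "real ((s - 1) * (n - 1)) \<le> real (s * c)" using c(2) by (simp only: of_nat_le_iff)
    then have "(real s - 1) * (real n - 1) \<le> real s * real c"
      using s n by (simp add: of_nat_diff)
    then have "(real s - 1) * (real n - 1) / (real s * real n) \<le> real s * real c / (real s * real n)"
      by (rule divide_right_mono) simp
    then show "(1 - 1 / real s) * (1 - 1 / real n) \<le> csat_ratio (path_graph r) n"
      using s n0 by (simp add: csat_ratio_def c_def field_simps)
    have "real n < real (s * (n div s) + s)"
      using dividend_less_times_div[OF s(1), of n] by (simp only: of_nat_less_iff)
    then have "real n / real s \<le> real (n div s) + 1"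
      using s by (simp add: field_simps)
    moreover have "real c \<le> real n - real (n div s)"
      using c(1) by (metis div_le_dividend of_nat_diff of_nat_le_iff)
    ultimately have "real c \<le> real n - real n / real s + 1" by linarith
    then have "real c / real n \<le> (real n - real n / real s + 1) / real n"
      using n0 by (intro divide_right_mono) auto
    also have "\<dots> = 1 - 1 / real s + 1 / real n"
      using n0 s by (simp add: field_simps)
    finally show "csat_ratio (path_graph r) n \<le> 1 - 1 / real s + 1 / real n"
      by (simp add: csat_ratio_def c_def)
  qed
  have inv: "(\<lambda>n. 1 / real n) \<longlonglongrightarrow> 0" by (rule lim_1_over_n)
  have "csat_ratio (path_graph r) \<longlonglongrightarrow> 1 - 1 / real s"
  proof (rule tendsto_sandwich)
    show "\<forall>\<^sub>F n in sequentially. (1 - 1 / real s) * (1 - 1 / real n) \<le> csat_ratio (path_graph r) n"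
      using lower eventually_sequentially by blast
    show "\<forall>\<^sub>F n in sequentially. csat_ratio (path_graph r) n \<le> 1 - 1 / real s + 1 / real n"
      using upper eventually_sequentially by blast
    have "(\<lambda>n. (1 - 1 / real s) * (1 - 1 / real n)) \<longlonglongrightarrow> (1 - 1 / real s) * (1 - 0)"
      by (intro tendsto_intros inv)
    then show "(\<lambda>n. (1 - 1 / real s) * (1 - 1 / real n)) \<longlonglongrightarrow> 1 - 1 / real s" by simp
    have "(\<lambda>n. 1 - 1 / real s + 1 / real n) \<longlonglongrightarrow> 1 - 1 / real s + 0"
      by (intro tendsto_intros inv)
    then show "(\<lambda>n. 1 - 1 / real s + 1 / real n) \<longlonglongrightarrow> 1 - 1 / real s" by simp
  qed
  then show ?thesis by (simp add: s_def)
qed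

theorem theorem4p2:
  fixes r :: nat
  assumes "r \<ge> 3"
  shows "convergent (csat_ratio (path_graph r)) \<and>
    (\<forall>j::nat. j \<ge> 1 \<longrightarrow>
       (r = 2 * j + 1 \<longrightarrow> csat_limit (path_graph r) = 1 - 1 / (3 * real j)) \<and>
       (r = 2 * j + 2 \<longrightarrow> csat_limit (path_graph r) = 1 - 1 / (3 * real j + 1)))"
proof (intro conjI allI impI)
  (* (r - 1) div 2 is the j of both cases *)
  have "csat_ratio (path_graph r) \<longlonglongrightarrow> 1 - 1 / real (r + (r - 1) div 2 - 1)"
    using assms by (intro csat_ratio_path_graph_tendsto) auto
  then show "convergent (csat_ratio (path_graph r))" by (rule convergentI)
next
  fix j :: nat
  assume j: "j \<ge> 1" and r: "r = 2 * j + 1"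
  have "csat_limit (path_graph r) = 1 - 1 / real (r + j - 1)"
    unfolding csat_limit_def using assms j r by (intro limI csat_ratio_path_graph_tendsto) auto
  then show "csat_limit (path_graph r) = 1 - 1 / (3 * real j)" by (simp add: r)
next
  fix j :: nat
  assume j: "j \<ge> 1" and r: "r = 2 * j + 2"
  have "csat_limit (path_graph r) = 1 - 1 / real (r + j - 1)"
    unfolding csat_limit_def using assms j r by (intro limI csat_ratio_path_graph_tendsto) auto
  then show "csat_limit (path_graph r) = 1 - 1 / (3 * real j + 1)" by (simp add: r)
qed

end
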